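(* Let $X\in\mathfrak{sl}(2,k)\setminus\{0\}$. Then $X$ belongs to the image of the moment map $\mu:S^3((k^2)^* )\to\mathfrak{sl}(2,k)$ if and only if $\nu_{\det X}(X)=[2]$ in $k^*/k^*_{\det X}$.
   Context: $k$ is a field of characteristic different from $2$ and $3$; $x,y$ is the standard coordinate basis of $(k^2)^*$; $S^3((k^2)^* )=\{ax^3+3bx^2y+3cxy^2+dy^3: a,b,c,d\in k\}$. The moment map is $$\mu(ax^3+3bx^2y+3cxy^2+dy^3)=\begin{pmatrix} ad-bc & 2(bd-c^2)\\ 2(b^2-ac) & -(ad-bc)\end{pmatrix}.$$ $(k^2)^*$ carries the symplectic form $\Omega(ax+by,a'x+b'y)=ab'-ba'$, and $\mathfrak{sl}(2,k)$ acts on $(k^2)^*$ by $\begin{pmatrix}\alpha&\beta\\ \gamma&-\alpha\end{pmatrix}\cdot x=-\alpha x-\beta y$, $\begin{pmatrix}\alpha&\beta\\ \gamma&-\alpha\end{pmatrix}\cdot y=-\gamma x+\alpha y$. For $\Delta\in k$, $k^*_\Delta=\{z\in k^*:\exists\, a,b\in k\text{ such that }z=a^2+b^2\Delta\}$, a subgroup of $k^*$. For $X\in\mathfrak{sl}(2,k)\setminus\{0\}$ with $\det X=\Delta$, $\nu_\Delta(X)=[\Omega(v,X\cdot v)]\in k^*/k^*_\Delta$, where $v$ is any nonzero element of $(k^2)^*$ which is not an eigenvector of $X$ (the class does not depend on the choice of $v$). *)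

theory Defs
  imports
    "HOL-Analysis.Determinants"
    "HOL-Algebra.Coset"
    "HOL-Computational_Algebra.Polynomial"
begin

text \<open>
  The symmetric algebra of the dual plane \<open>(k\<^sup>2)\<^sup>*\<close> is \<open>k[x,y]\<close>, rendered as \<open>k[x][y]\<close>:
  a polynomial in \<open>y\<close> whose coefficients are polynomials in \<open>x\<close>.
  The dual plane itself is the space of linear forms and \<open>S\<^sup>3\<close> is the space of binary cubics.
\<close>

definition const :: "'a::field \<Rightarrow> 'a poly poly"
  where "const c = [:[:c:]:]"

definition varx :: "'a::field poly poly"
  where "varx = [:[:0, 1:]:]"

definition vary :: "'a::field poly poly"
  where "vary = [:0, 1:]"

text \<open>The coefficient of \<open>x\<^sup>i y\<^sup>j\<close>.\<close>

definition mcoeff :: "'a::field poly poly \<Rightarrow> nat \<Rightarrow> nat \<Rightarrow> 'a"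
  where "mcoeff p i j = coeff (coeff p j) i"

definition linear_form :: "'a::field \<Rightarrow> 'a \<Rightarrow> 'a poly poly"
  where "linear_form a b = const a * varx + const b * vary"

definition dual_plane :: "'a::field poly poly set"
  where "dual_plane = {linear_form a b | a b. True}"

definition cubic :: "'a::field \<Rightarrow> 'a \<Rightarrow> 'a \<Rightarrow> 'a \<Rightarrow> 'a poly poly"
  where "cubic a b c d =
    const a * varx ^ 3 + const (3 * b) * varx ^ 2 * vary
      + const (3 * c) * varx * vary ^ 2 + const d * vary ^ 3"

definition binary_cubics :: "'a::field poly poly set"
  where "binary_cubics = {cubic a b c d | a b c d. True}"

definition mat2 :: "'a::zero \<Rightarrow> 'a \<Rightarrow> 'a \<Rightarrow> 'a \<Rightarrow> 'a ^ 2 ^ 2"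
  where "mat2 p q r s = vector [vector [p, q], vector [r, s]]"

definition sl2 :: "('a::field ^ 2 ^ 2) set"
  where "sl2 = {X. trace X = 0}"

text \<open>The lemma \<open>moment_map_cubic\<close> below gives the value on \<open>cubic a b c d\<close> when \<open>3 \<noteq> 0\<close>.\<close>

definition moment_map :: "'a::field poly poly \<Rightarrow> 'a ^ 2 ^ 2"
  where "moment_map p =
    (let a = mcoeff p 3 0; b = mcoeff p 2 1 / 3; c = mcoeff p 1 2 / 3; d = mcoeff p 0 3
     in mat2 (a * d - b * c)       (2 * (b * d - c\<^sup>2))
             (2 * (b\<^sup>2 - a * c))   (- (a * d - b * c)))"

definition Omega :: "'a::field poly poly \<Rightarrow> 'a poly poly \<Rightarrow> 'a"
  where "Omega v w = mcoeff v 1 0 * mcoeff w 0 1 - mcoeff v 0 1 * mcoeff w 1 0"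

text \<open>The action of \<open>sl2\<close> on \<open>dual_plane\<close>, extended linearly from its values on \<open>x\<close> and \<open>y\<close>.\<close>

definition sl2_act :: "'a::field ^ 2 ^ 2 \<Rightarrow> 'a poly poly \<Rightarrow> 'a poly poly"
  where "sl2_act X v =
    (let \<alpha> = X $ 1 $ 1; \<beta> = X $ 1 $ 2; \<gamma> = X $ 2 $ 1
     in const (mcoeff v 1 0) * linear_form (- \<alpha>) (- \<beta>)
        + const (mcoeff v 0 1) * linear_form (- \<gamma>) \<alpha>)"

definition is_eigenvector :: "'a::field ^ 2 ^ 2 \<Rightarrow> 'a poly poly \<Rightarrow> bool"
  where "is_eigenvector X v \<longleftrightarrow>
    v \<in> dual_plane \<and> v \<noteq> 0 \<and> (\<exists>c. sl2_act X v = const c * v)"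

definition kstar :: "'a::field monoid"
  where "kstar = \<lparr>carrier = {z. z \<noteq> 0}, mult = (*), one = 1\<rparr>"

definition kstar_sub :: "'a::field \<Rightarrow> 'a set"
  where "kstar_sub \<Delta> = {z \<in> carrier kstar. \<exists>a b. z = a\<^sup>2 + b\<^sup>2 * \<Delta>}"

text \<open>The class of \<open>z\<close> in the quotient group \<open>kstar Mod kstar_sub \<Delta>\<close>.\<close>

definition kclass :: "'a::field \<Rightarrow> 'a \<Rightarrow> 'a set"
  where "kclass \<Delta> z = kstar_sub \<Delta> #>\<^bsub>kstar\<^esub> z"

text \<open>
  Only meaningful for nonzero \<open>X \<in> sl2\<close> with \<open>det X = \<Delta>\<close>; existence and uniqueness of the
  class are the lemmas \<open>ex_not_eigenvector\<close> and \<open>nu_eq\<close> below.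
\<close>

definition nu :: "'a::field \<Rightarrow> 'a ^ 2 ^ 2 \<Rightarrow> 'a set"
  where "nu \<Delta> X = (THE C. \<exists>v \<in> dual_plane. v \<noteq> 0 \<and> \<not> is_eigenvector X v
    \<and> C = kclass \<Delta> (Omega v (sl2_act X v)))"


lemma mcoeff_linear_form [simp]:
  "mcoeff (linear_form a b) 1 0 = a" "mcoeff (linear_form a b) 0 1 = b"
  "mcoeff (linear_form a b) (Suc 0) 0 = a" "mcoeff (linear_form a b) 0 (Suc 0) = b"
  by (simp_all add: mcoeff_def linear_form_def const_def varx_def vary_def)

lemma linear_form_eq_iff [simp]: "linear_form a b = linear_form c d \<longleftrightarrow> a = c \<and> b = d"
  by (metis mcoeff_linear_form(1,2))

lemma const_mult_linear_form: "const c * linear_form a b = linear_form (c * a) (c * b)"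
  by (simp add: linear_form_def const_def varx_def vary_def)

lemma linear_form_add: "linear_form a b + linear_form c d = linear_form (a + c) (b + d)"
  by (simp add: linear_form_def const_def varx_def vary_def)

lemma linear_form_0: "linear_form 0 0 = 0"
  by (simp add: linear_form_def const_def)

lemma linear_form_eq_0_iff: "linear_form a b = 0 \<longleftrightarrow> a = 0 \<and> b = 0"
  by (metis linear_form_0 linear_form_eq_iff)

lemma moment_map_cubic:
  assumes "(3::'a::field) \<noteq> 0"
  shows "moment_map (cubic a b c (d::'a)) =
    mat2 (a * d - b * c) (2 * (b * d - c\<^sup>2)) (2 * (b\<^sup>2 - a * c)) (- (a * d - b * c))"
proof -
  have "mcoeff (cubic a b c d) 3 0 = a" "mcoeff (cubic a b c d) 2 1 = 3 * b"
    "mcoeff (cubic a b c d) 1 2 = 3 * c" "mcoeff (cubic a b c d) 0 3 = d"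
    by (simp_all add: mcoeff_def cubic_def const_def varx_def vary_def
        numeral_2_eq_2 numeral_3_eq_3)
  then show ?thesis
    using assms by (simp add: moment_map_def Let_def)
qed

lemma moment_map_in_sl2: "moment_map p \<in> sl2"
  by (simp add: moment_map_def Let_def sl2_def trace_def mat2_def sum_2)

lemma Omega_linear_form: "Omega (linear_form a b) (linear_form a' b') = a * b' - b * a'"
  by (simp add: Omega_def)

lemma sl2_act_linear_form:
  "sl2_act X (linear_form p q) =
    linear_form (- (X $ 1 $ 1) * p - X $ 2 $ 1 * q) (- (X $ 1 $ 2) * p + X $ 1 $ 1 * q)"
  by (simp add: sl2_act_def Let_def const_mult_linear_form linear_form_add algebra_simps)

lemma sl2_entry: "X \<in> sl2 \<Longrightarrow> X $ 2 $ 2 = - (X $ 1 $ 1)"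
  by (simp add: sl2_def trace_def sum_2 eq_neg_iff_add_eq_0 add.commute)

lemma comm_group_kstar: "comm_group (kstar :: 'a::field monoid)"
proof (rule comm_groupI)
  fix x :: 'a assume "x \<in> carrier kstar"
  then show "\<exists>y\<in>carrier kstar. y \<otimes>\<^bsub>kstar\<^esub> x = \<one>\<^bsub>kstar\<^esub>"
    by (intro bexI[of _ "inverse x"]) (simp_all add: kstar_def)
qed (simp_all add: kstar_def)

lemma subgroup_kstar_sub: "subgroup (kstar_sub \<Delta>) (kstar :: 'a::field monoid)"
proof (rule group.subgroupI)
  show "group (kstar :: 'a monoid)"
    using comm_group_kstar by (rule comm_group.axioms)
  show "kstar_sub \<Delta> \<subseteq> carrier kstar"
    by (auto simp: kstar_sub_def)
  have "(1::'a) = 1\<^sup>2 + 0\<^sup>2 * \<Delta>" by simp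
  then have "1 \<in> kstar_sub \<Delta>"
    unfolding kstar_sub_def kstar_def by fastforce
  then show "kstar_sub \<Delta> \<noteq> {}" by blast
next
  fix z assume "z \<in> kstar_sub \<Delta>"
  then obtain a b where z: "z \<noteq> 0" "z = a\<^sup>2 + b\<^sup>2 * \<Delta>"
    by (auto simp: kstar_sub_def kstar_def)
  have "inverse z = z / z\<^sup>2"
    using z(1) by (simp add: power2_eq_square inverse_eq_divide)
  also have "\<dots> = (a\<^sup>2 + b\<^sup>2 * \<Delta>) / z\<^sup>2"
    using z(2) by simp
  also have "\<dots> = (a / z)\<^sup>2 + (b / z)\<^sup>2 * \<Delta>"
    by (simp add: power_divide add_divide_distrib)
  finally have *: "inverse z \<in> kstar_sub \<Delta>"
    using z(1) by (auto simp: kstar_sub_def kstar_def)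
  have "inv\<^bsub>kstar\<^esub> z = inverse z"
    by (rule group.inv_equality[OF comm_group.axioms(2)[OF comm_group_kstar]])
      (use z(1) in \<open>simp_all add: kstar_def\<close>)
  with * show "inv\<^bsub>kstar\<^esub> z \<in> kstar_sub \<Delta>" by simp
next
  fix z w assume "z \<in> kstar_sub \<Delta>" "w \<in> kstar_sub \<Delta>"
  then obtain a b c d where zw: "z \<noteq> 0" "z = a\<^sup>2 + b\<^sup>2 * \<Delta>" "w \<noteq> 0" "w = c\<^sup>2 + d\<^sup>2 * \<Delta>"
    by (auto simp: kstar_sub_def kstar_def)
  have "z * w = (a * c - b * d * \<Delta>)\<^sup>2 + (a * d + b * c)\<^sup>2 * \<Delta>"
    unfolding zw(2,4) by (simp add: power2_eq_square algebra_simps)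
  then show "z \<otimes>\<^bsub>kstar\<^esub> w \<in> kstar_sub \<Delta>"
    using zw(1,3) unfolding kstar_sub_def kstar_def by auto
qed

lemma kclass_in_quotient: "z \<noteq> 0 \<Longrightarrow> kclass \<Delta> z \<in> carrier (kstar Mod kstar_sub \<Delta>)"
  by (auto simp: kclass_def FactGroup_def RCOSETS_def kstar_def)

lemma kclass_eqI:
  assumes "z \<noteq> 0" "w \<noteq> 0" "z * w = a\<^sup>2 + b\<^sup>2 * \<Delta>"
  shows "kclass \<Delta> z = kclass \<Delta> (w::'a::field)"
proof -
  interpret comm_group "kstar :: 'a monoid" by (rule comm_group_kstar)
  have "z / w = z * w / w\<^sup>2"
    using assms(2) by (simp add: power2_eq_square)
  also have "\<dots> = (a / w)\<^sup>2 + (b / w)\<^sup>2 * \<Delta>"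
    by (simp add: assms(3) power_divide add_divide_distrib)
  finally have "z / w \<in> kstar_sub \<Delta>"
    using assms(1,2) by (auto simp: kstar_sub_def kstar_def)
  moreover have "z = (z / w) \<otimes>\<^bsub>kstar\<^esub> w"
    using assms(2) by (simp add: kstar_def)
  ultimately have "z \<in> kstar_sub \<Delta> #>\<^bsub>kstar\<^esub> w"
    unfolding r_coset_def by blast
  moreover have "w \<in> carrier kstar"
    using assms(2) by (simp add: kstar_def)
  ultimately show ?thesis
    unfolding kclass_def using repr_independence subgroup_kstar_sub by metis
qed

lemma Omega_act_nonzero:
  assumes "v \<in> dual_plane" "v \<noteq> 0" "\<not> is_eigenvector X v"
  shows "Omega v (sl2_act X v) \<noteq> 0"
proof
  assume 0: "Omega v (sl2_act X v) = 0"
  obtain p q where v: "v = linear_form p q"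
    using assms(1) by (auto simp: dual_plane_def)
  obtain r s where w: "sl2_act X v = linear_form r s"
    by (simp add: v sl2_act_linear_form)
  have eq: "p * s = q * r"
    using 0 unfolding w by (simp add: v Omega_linear_form)
  have "p \<noteq> 0 \<or> q \<noteq> 0"
    using assms(2) by (simp add: v linear_form_eq_0_iff)
  then have "\<exists>c. r = c * p \<and> s = c * q"
  proof
    assume "p \<noteq> 0"
    then show ?thesis using eq by (intro exI[of _ "r / p"]) (simp add: field_simps)
  next
    assume "q \<noteq> 0"
    then show ?thesis using eq by (intro exI[of _ "s / q"]) (simp add: field_simps)
  qed
  then have "is_eigenvector X v"
    using assms(1,2) w unfolding is_eigenvector_def v by (auto simp: const_mult_linear_form)
  with assms(3) show False by blast
qed

lemma ex_not_eigenvector: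
  fixes X :: "'a::field ^ 2 ^ 2"
  assumes "(2::'a) \<noteq> 0" "X \<in> sl2" "X \<noteq> 0"
  shows "\<exists>v \<in> dual_plane. v \<noteq> 0 \<and> \<not> is_eigenvector X v"
proof (rule ccontr)
  assume neg: "\<not> ?thesis"
  have eig: "\<exists>c. sl2_act X (linear_form p q) = const c * linear_form p q"
    if "p \<noteq> 0 \<or> q \<noteq> 0" for p q
  proof -
    have "linear_form p q \<noteq> 0" "linear_form p q \<in> dual_plane"
      using that by (auto simp: linear_form_eq_0_iff dual_plane_def)
    then show ?thesis using neg unfolding is_eigenvector_def by blast
  qed
  have "X $ 1 $ 2 = 0" using eig[of 1 0]
    by (auto simp: sl2_act_linear_form const_mult_linear_form)
  moreover have "X $ 2 $ 1 = 0" using eig[of 0 1]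
    by (auto simp: sl2_act_linear_form const_mult_linear_form)
  moreover have "X $ 1 $ 1 = 0"
  proof -
    have "- (X $ 1 $ 1) = X $ 1 $ 1"
      using eig[of 1 1] calculation by (auto simp: sl2_act_linear_form const_mult_linear_form)
    then have "2 * X $ 1 $ 1 = 0" by (metis add.right_inverse mult_2)
    then show ?thesis using assms(1) by simp
  qed
  ultimately have "X = 0"
    using sl2_entry[OF assms(2)] by (simp add: vec_eq_iff forall_2)
  with assms(3) show False by blast
qed

lemma nu_eq:
  fixes X :: "'a::field ^ 2 ^ 2"
  assumes "X \<in> sl2" "v \<in> dual_plane" "v \<noteq> 0" "\<not> is_eigenvector X v"
  shows "nu (det X) X = kclass (det X) (Omega v (sl2_act X v))"
proof -
  have "kclass (det X) (Omega w (sl2_act X w)) = kclass (det X) (Omega v (sl2_act X v))"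
    if w: "w \<in> dual_plane" "w \<noteq> 0" "\<not> is_eigenvector X w" for w
  proof -
    obtain p q where v': "v = linear_form p q"
      using assms(2) by (auto simp: dual_plane_def)
    obtain s t where w': "w = linear_form s t"
      using w(1) by (auto simp: dual_plane_def)
    show ?thesis
    proof (rule kclass_eqI)
      show "Omega w (sl2_act X w) \<noteq> 0" "Omega v (sl2_act X v) \<noteq> 0"
        using Omega_act_nonzero assms w by blast+
      show "Omega w (sl2_act X w) * Omega v (sl2_act X v) =
          (- (X $ 1 $ 2) * p * s + X $ 1 $ 1 * (p * t + q * s) + X $ 2 $ 1 * q * t)\<^sup>2
            + (p * t - q * s)\<^sup>2 * det X"
        by (simp add: v' w' sl2_act_linear_form Omega_linear_form det_2 sl2_entry[OF assms(1)]
            power2_eq_square algebra_simps)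
    qed
  qed
  then show ?thesis
    unfolding nu_def using assms(2-4) by (intro the_equality) blast+
qed

end

theory Submission
  imports Defs
begin

text \<open>
  For \<open>X\<close> with rows \<open>(\<alpha>, \<beta>)\<close> and \<open>(\<gamma>, -\<alpha>)\<close> and \<open>v = p x + q y\<close>, the number
  \<open>\<Omega>(v, X \<cdot> v)\<close> equals \<open>2 H(p, q)\<close> for the binary quadratic form
  \<open>H(p, q) = A p\<^sup>2 + B p q + C q\<^sup>2\<close> with \<open>A = -\<beta>/2\<close>, \<open>B = \<alpha>\<close>, \<open>C = \<gamma>/2\<close>, and
  \<open>det X = 4 A C - B\<^sup>2\<close> is minus the discriminant of \<open>H\<close>. The vectors that are not eigenvectors
  are exactly those with \<open>H(v) \<noteq> 0\<close>, so \<open>\<nu>(X) = [2]\<close> says that \<open>H(v)\<close> is represented by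
  \<open>s\<^sup>2 + t\<^sup>2 det X\<close> for one such \<open>v\<close>, or equivalently for every such \<open>v\<close>. On the other side,
  \<open>X\<close> is the moment of \<open>a x\<^sup>3 + 3b x\<^sup>2y + 3c xy\<^sup>2 + d y\<^sup>3\<close> exactly when \<open>H\<close> is the Hessian
  \<open>(c\<^sup>2 - b d) p\<^sup>2 + (a d - b c) p q + (b\<^sup>2 - a c) q\<^sup>2\<close> of the cubic, transported to the dual
  coordinates \<open>p, q\<close>. The theorem is thus a description of the Hessians of binary cubics.

  A Hessian has the required values by the classical syzygy \<open>G\<^sup>2 + \<Delta> F\<^sup>2 = 4 H\<^sup>3\<close>
  between a cubic \<open>F\<close>, its Hessian and its cubic covariant \<open>G\<close> (\<open>hessian_syzygy\<close>): dividing
  by \<open>4 H\<^sup>2\<close> represents \<open>H(v)\<close> by the form \<open>s\<^sup>2 + t\<^sup>2 \<Delta>\<close>.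

  Conversely the syzygy tells how to choose the cubic (\<open>quadratic_form_is_hessian\<close>). If
  \<open>A = s\<^sup>2 + t\<^sup>2 \<Delta>\<close> is nonzero then \<open>4 A\<^sup>3 = (2sA)\<^sup>2 + \<Delta> (2tA)\<^sup>2\<close>, so one looks for a cubic with
  \<open>F(1, 0) = 2tA\<close>; after a shear that removes \<open>B\<close>, the remaining coefficients
  are forced, up to the sign of \<open>c = \<plusminus>s\<close>, by the Hessian equations. Exchanging the two coordinates covers \<open>C \<noteq> 0\<close>. If \<open>A = C = 0\<close>, then
  \<open>H = B p q\<close> is the Hessian of \<open>B x\<^sup>3 + y\<^sup>3\<close>.
\<close>

section \<open>Hessians of binary cubics\<close>

text \<open>
  The cubic \<open>F = d p\<^sup>3 - 3c p\<^sup>2q + 3b pq\<^sup>2 - a q\<^sup>3\<close> is the cubic with coefficients \<open>a, b, c, d\<close>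
  rewritten in dual coordinates by means of the symplectic form. The long factor on the right is its covariant \<open>G\<close>,
  the Jacobian of \<open>F\<close> and its Hessian up to a constant.
\<close>

lemma hessian_syzygy:
  fixes a b c d p q :: "'a::field"
  defines "A \<equiv> c\<^sup>2 - b * d" and "B \<equiv> a * d - b * c" and "C \<equiv> b\<^sup>2 - a * c"
  shows "4 * (A * p\<^sup>2 + B * p * q + C * q\<^sup>2) ^ 3 =
    ((3 * b * c * d - a * d\<^sup>2 - 2 * c ^ 3) * p ^ 3
      + 3 * (a * c * d - 2 * b\<^sup>2 * d + b * c\<^sup>2) * p\<^sup>2 * q
      + 3 * (a * b * d - 2 * a * c\<^sup>2 + b\<^sup>2 * c) * p * q\<^sup>2
      - (a\<^sup>2 * d - 3 * a * b * c + 2 * b ^ 3) * q ^ 3)\<^sup>2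
    + (d * p ^ 3 - 3 * c * p\<^sup>2 * q + 3 * b * p * q\<^sup>2 - a * q ^ 3)\<^sup>2 * (4 * A * C - B\<^sup>2)"
  unfolding A_def B_def C_def by algebra

text \<open>
  Eliminating \<open>a\<close> from \<open>a d = b c\<close> and \<open>b\<^sup>2 - a c = C\<close> gives \<open>b = - C d / A\<close>, whence
  \<open>c\<^sup>2 = A - \<Delta> d\<^sup>2 / (4A\<^sup>2)\<close>. The choice \<open>d = 2 t A\<close> makes this the square \<open>s\<^sup>2\<close>.
\<close>

lemma diagonal_form_is_hessian:
  fixes A C s t :: "'a::field"
  assumes "A \<noteq> 0" "A = s\<^sup>2 + t\<^sup>2 * (4 * A * C)"
  obtains a b c d where "c\<^sup>2 - b * d = A" "a * d - b * c = 0" "b\<^sup>2 - a * c = C"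
proof
  let ?a = "- C * s / A" and ?b = "- 2 * t * C" and ?c = s and ?d = "2 * t * A"
  show "?c\<^sup>2 - ?b * ?d = A"
    using assms(2) by (simp add: algebra_simps power2_eq_square)
  show "?a * ?d - ?b * ?c = 0"
    using assms(1) by (simp add: algebra_simps)
  have "?b\<^sup>2 - ?a * ?c = C / A * (s\<^sup>2 + t\<^sup>2 * (4 * A * C))"
    using assms(1) by (simp add: field_simps power2_eq_square)
  also have "\<dots> = C"
    using assms by simp
  finally show "?b\<^sup>2 - ?a * ?c = C" .
qed

text \<open>
  Completing the square in \<open>H\<close> corresponds to the substitution \<open>y \<mapsto> y + e x\<close> in
  the cubic, and it preserves \<open>\<Delta> = 4AC - B\<^sup>2\<close>.
\<close>

lemma quadratic_form_is_hessian:
  fixes A B C s t :: "'a::field"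
  assumes two: "(2::'a) \<noteq> 0" and A: "A \<noteq> 0" "A = s\<^sup>2 + t\<^sup>2 * (4 * A * C - B\<^sup>2)"
  obtains a b c d where "c\<^sup>2 - b * d = A" "a * d - b * c = B" "b\<^sup>2 - a * c = C"
proof -
  define e where "e = - B / (2 * A)"
  have B: "B = - 2 * e * A"
    using two A(1) by (simp add: e_def)
  have "A = s\<^sup>2 + t\<^sup>2 * (4 * A * (C - e\<^sup>2 * A))"
    by (subst A(2)) (simp add: B power2_eq_square algebra_simps)
  then obtain a b c d where
    eqs: "c\<^sup>2 - b * d = A" "a * d - b * c = 0" "b\<^sup>2 - a * c = C - e\<^sup>2 * A"
    using diagonal_form_is_hessian[OF A(1)] by metis
  let ?a = "a + 3 * e * b + 3 * e\<^sup>2 * c + e ^ 3 * d"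
    and ?b = "b + 2 * e * c + e\<^sup>2 * d" and ?c = "c + e * d"
  show thesis
  proof
    have "?c\<^sup>2 - ?b * d = c\<^sup>2 - b * d"
      by algebra
    then show "?c\<^sup>2 - ?b * d = A"
      by (simp only: eqs)
    have "?a * d - ?b * ?c = (a * d - b * c) - 2 * e * (c\<^sup>2 - b * d)"
      by algebra
    then show "?a * d - ?b * ?c = B"
      by (simp only: eqs B) simp
    have "?b\<^sup>2 - ?a * ?c = (b\<^sup>2 - a * c) - e * (a * d - b * c) + e\<^sup>2 * (c\<^sup>2 - b * d)"
      by algebra
    then show "?b\<^sup>2 - ?a * ?c = C"
      by (simp only: eqs) simp
  qed
qed

section \<open>Moments and the invariant in coordinates\<close>

lemma in_image_moment_map_iff:
  fixes X :: "'a::field ^ 2 ^ 2"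
  assumes "(3::'a) \<noteq> 0" "X \<in> sl2"
  shows "X \<in> moment_map ` binary_cubics \<longleftrightarrow>
    (\<exists>a b c d. X $ 1 $ 1 = a * d - b * c \<and> X $ 1 $ 2 = - 2 * (c\<^sup>2 - b * d)
      \<and> X $ 2 $ 1 = 2 * (b\<^sup>2 - a * c))"
proof -
  have "X = moment_map (cubic a b c d) \<longleftrightarrow>
      X $ 1 $ 1 = a * d - b * c \<and> X $ 1 $ 2 = - 2 * (c\<^sup>2 - b * d)
        \<and> X $ 2 $ 1 = 2 * (b\<^sup>2 - a * c)" for a b c d
    by (auto simp: moment_map_cubic[OF assms(1)] mat2_def vec_eq_iff forall_2
        sl2_entry[OF assms(2)] algebra_simps)
  then show ?thesis
    unfolding image_def binary_cubics_def by blast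
qed

lemma Omega_sl2_act:
  "Omega (linear_form p q) (sl2_act X (linear_form p q)) =
    - (X $ 1 $ 2) * p\<^sup>2 + 2 * X $ 1 $ 1 * p * q + X $ 2 $ 1 * q\<^sup>2"
  by (simp add: sl2_act_linear_form Omega_linear_form power2_eq_square algebra_simps)

lemma Omega_nonzero_not_eigenvector:
  assumes "Omega (linear_form p q) (sl2_act X (linear_form p q)) \<noteq> 0"
  shows "linear_form p q \<noteq> 0" "\<not> is_eigenvector X (linear_form p q)"
proof -
  show "linear_form p q \<noteq> 0"
    using assms by (auto simp: linear_form_eq_0_iff Omega_sl2_act)
  show "\<not> is_eigenvector X (linear_form p q)"
  proof
    assume "is_eigenvector X (linear_form p q)"
    then obtain c where "sl2_act X (linear_form p q) = linear_form (c * p) (c * q)"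
      by (auto simp: is_eigenvector_def const_mult_linear_form)
    then show False
      using assms by (simp add: Omega_linear_form)
  qed
qed

lemma kclass_eqD:
  fixes z w :: "'a::field"
  assumes "z \<noteq> 0" "kclass \<Delta> z = kclass \<Delta> w"
  obtains s t where "z = (s\<^sup>2 + t\<^sup>2 * \<Delta>) * w"
proof -
  interpret comm_group "kstar :: 'a monoid" by (rule comm_group_kstar)
  have "z \<in> kclass \<Delta> z"
    using assms(1) rcos_self[OF _ subgroup_kstar_sub, of z \<Delta>]
    by (simp add: kclass_def kstar_def)
  then show thesis
    using that unfolding assms(2) by (auto simp: kclass_def r_coset_def kstar_sub_def kstar_def)
qed

text \<open>
  The class \<open>\<nu>(X)\<close> may be computed from any vector off the eigenlines; each of them thus yields
  a representation, which is what makes it possible to work with basis vectors only.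
\<close>

lemma nu_eq_two_imp_represented:
  fixes X :: "'a::field ^ 2 ^ 2"
  assumes "X \<in> sl2" "nu (det X) X = kclass (det X) 2"
    and "Omega (linear_form p q) (sl2_act X (linear_form p q)) \<noteq> 0"
  obtains s t where
    "Omega (linear_form p q) (sl2_act X (linear_form p q)) = (s\<^sup>2 + t\<^sup>2 * det X) * 2"
proof -
  have "linear_form p q \<in> dual_plane"
    by (auto simp: dual_plane_def)
  then have "nu (det X) X = kclass (det X) (Omega (linear_form p q) (sl2_act X (linear_form p q)))"
    using nu_eq assms(1) Omega_nonzero_not_eigenvector[OF assms(3)] by blast
  then show thesis
    using kclass_eqD assms(2,3) that by metis
qed

section \<open>The image of the moment map\<close>

lemma moment_imp_nu_eq_two:
  fixes X :: "'a::field ^ 2 ^ 2"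
  assumes two: "(2::'a) \<noteq> 0" and X: "X \<in> sl2" "X \<noteq> 0"
    and entries: "X $ 1 $ 1 = a * d - b * c" "X $ 1 $ 2 = - 2 * (c\<^sup>2 - b * d)"
      "X $ 2 $ 1 = 2 * (b\<^sup>2 - a * c)"
  shows "nu (det X) X = kclass (det X) 2"
proof -
  obtain v where v: "v \<in> dual_plane" "v \<noteq> 0" "\<not> is_eigenvector X v"
    using ex_not_eigenvector[OF two X] by blast
  obtain p q where pq: "v = linear_form p q"
    using v(1) by (auto simp: dual_plane_def)
  define H where "H = (c\<^sup>2 - b * d) * p\<^sup>2 + (a * d - b * c) * p * q + (b\<^sup>2 - a * c) * q\<^sup>2"
  have Om: "Omega v (sl2_act X v) = 2 * H"
    by (simp add: pq Omega_sl2_act entries H_def algebra_simps)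
  then have "H \<noteq> 0"
    using Omega_act_nonzero[OF v] by auto
  have det: "det X = 4 * (c\<^sup>2 - b * d) * (b\<^sup>2 - a * c) - (a * d - b * c)\<^sup>2"
    by (simp add: det_2 sl2_entry[OF X(1)] entries power2_eq_square algebra_simps)
  obtain F G where "4 * H ^ 3 = G\<^sup>2 + F\<^sup>2 * det X"
    unfolding H_def det using hessian_syzygy by blast
  then have "(G / H)\<^sup>2 + (F / H)\<^sup>2 * det X = 4 * H ^ 3 / H\<^sup>2"
    by (simp add: power_divide add_divide_distrib)
  also have "\<dots> = 2 * H * 2"
    using \<open>H \<noteq> 0\<close> by (simp add: power2_eq_square power3_eq_cube)
  finally have "2 * H * 2 = (G / H)\<^sup>2 + (F / H)\<^sup>2 * det X" ..
  then have "kclass (det X) (2 * H) = kclass (det X) 2"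
    using kclass_eqI two \<open>H \<noteq> 0\<close> by (metis mult_eq_0_iff)
  then show ?thesis
    using nu_eq[OF X(1) v] Om by simp
qed

lemma nu_eq_two_imp_moment:
  fixes X :: "'a::field ^ 2 ^ 2"
  assumes two: "(2::'a) \<noteq> 0" and X: "X \<in> sl2" and nu: "nu (det X) X = kclass (det X) 2"
  shows "\<exists>a b c d. X $ 1 $ 1 = a * d - b * c \<and> X $ 1 $ 2 = - 2 * (c\<^sup>2 - b * d)
    \<and> X $ 2 $ 1 = 2 * (b\<^sup>2 - a * c)"
proof -
  define A B C where "A = - (X $ 1 $ 2) / 2" and "B = X $ 1 $ 1" and "C = X $ 2 $ 1 / 2"
  have entries: "X $ 1 $ 1 = B" "X $ 1 $ 2 = - 2 * A" "X $ 2 $ 1 = 2 * C"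
    using two by (simp_all add: A_def B_def C_def)
  have det: "det X = 4 * A * C - B\<^sup>2"
    by (simp add: det_2 sl2_entry[OF X] entries power2_eq_square)
  have "\<exists>a b c d. c\<^sup>2 - b * d = A \<and> a * d - b * c = B \<and> b\<^sup>2 - a * c = C"
  proof -
    consider "A \<noteq> 0" | "C \<noteq> 0" | "A = 0" "C = 0" by blast
    then show ?thesis
    proof cases
      case 1
      have Om: "Omega (linear_form 1 0) (sl2_act X (linear_form 1 0)) = A * 2"
        by (simp add: Omega_sl2_act entries)
      obtain s t where "A * 2 = (s\<^sup>2 + t\<^sup>2 * det X) * 2"
        using nu_eq_two_imp_represented[OF X nu, of 1 0] 1 two unfolding Om by auto
      then have "A = s\<^sup>2 + t\<^sup>2 * (4 * A * C - B\<^sup>2)"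
        using two unfolding det mult_right_cancel[OF two] by blast
      from quadratic_form_is_hessian[OF two 1 this] show ?thesis by metis
    next
      case 2
      have Om: "Omega (linear_form 0 1) (sl2_act X (linear_form 0 1)) = C * 2"
        by (simp add: Omega_sl2_act entries)
      obtain s t where "C * 2 = (s\<^sup>2 + t\<^sup>2 * det X) * 2"
        using nu_eq_two_imp_represented[OF X nu, of 0 1] 2 two unfolding Om by auto
      then have "C = s\<^sup>2 + t\<^sup>2 * (4 * C * A - B\<^sup>2)"
        using two unfolding det mult_right_cancel[OF two] by (simp only: ac_simps)
      \<comment> \<open>Reversing the coefficients of a cubic exchanges \<open>A\<close> and \<open>C\<close> and fixes \<open>B\<close>.\<close>
      from quadratic_form_is_hessian[OF two 2 this] obtain a b c d where
        "c\<^sup>2 - b * d = C" "a * d - b * c = B" "b\<^sup>2 - a * c = A" .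
      then show ?thesis
        by (intro exI[of _ d] exI[of _ c] exI[of _ b] exI[of _ a]) (simp add: mult.commute)
    next
      case 3
      then show ?thesis
        by (intro exI[of _ B] exI[of _ 0] exI[of _ 0] exI[of _ 1]) simp
    qed
  qed
  then show ?thesis
    unfolding entries by metis
qed

lemma of_nat_prime_nonzero:
  assumes "prime p" "CHAR('a::field) \<noteq> p"
  shows "(of_nat p :: 'a) \<noteq> 0"
  using assms by (auto simp: of_nat_eq_0_iff_char_dvd prime_nat_iff)

theorem theorem2p11:
  fixes X :: "'a::field ^ 2 ^ 2"
  assumes "CHAR('a) \<noteq> 2" and "CHAR('a) \<noteq> 3"
    and "X \<in> sl2 - {0}"
  shows "X \<in> moment_map ` binary_cubics \<longleftrightarrow> nu (det X) X = kclass (det X) 2"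
proof -
  have two: "(2::'a) \<noteq> 0"
    using of_nat_prime_nonzero[OF two_is_prime_nat assms(1)] by simp
  have "prime (3::nat)"
    by simp
  then have three: "(3::'a) \<noteq> 0"
    using of_nat_prime_nonzero[OF _ assms(2)] by simp
  have X: "X \<in> sl2" "X \<noteq> 0"
    using assms(3) by auto
  show ?thesis
    unfolding in_image_moment_map_iff[OF three X(1)]
    using moment_imp_nu_eq_two[OF two X] nu_eq_two_imp_moment[OF two X(1)] by blast
qed

end
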